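(* There exist Hilbert spaces $X,Y$, a bounded linear operator $A:X\to Y$, an element $x^\dagger\in N(A)^\perp$, a sequence of finite-dimensional subspaces $X_n\subset X$ ($n\in\mathbb{N}$) with $X_n\subset X_{n+1}$ and $\overline{\bigcup_nX_n}=X$, and elements $u,v\in X$ with $u\ne x^\dagger$ and $v\ne x^\dagger$, such that the projected least-squares solutions $x_n:=(AP_n)^\dagger Ax^\dagger$ satisfy $$x_{2n}\rightharpoonup u\ \text{ but }\ x_{2n}\not\to u,\qquad x_{2n+1}\rightharpoonup v\ \text{ but }\ x_{2n+1}\not\to v\qquad(n\to\infty),$$ and in particular the sequence $(x_n)$ converges neither weakly nor strongly, and no weakly convergent subsequence of $(x_n)$ has limit $x^\dagger$.
   Context: $N(A)$ denotes the nullspace of $A$, $P_n$ the orthogonal projector of $X$ onto $X_n$, and $T^\dagger$ the Moore–Penrose pseudoinverse of an operator $T$ with closed range ($T^\dagger y$ is the minimum-norm least-squares solution of $Tx=y$). $\to$ denotes norm convergence and $\rightharpoonup$ weak convergence. *)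

theory Defs
  imports "HOL-Analysis.Analysis"
begin

section \<open>The real sequence space of square-summable sequences\<close>

text \<open>
  HOL cannot quantify existentially over types, so Hilbert spaces are represented as complete
  linear subspaces of one ambient Hilbert space. The ambient space is the real sequence space
  \<open>\<ell>\<^sup>2\<close>, whose complete subspaces are, up to isometric isomorphism, exactly the
  separable real Hilbert spaces. A Hilbert space with an increasing sequence of finite-dimensional
  subspaces whose union is dense is automatically separable, and so is the closure of its image
  under a bounded operator.
\<close>

typedef ell2 = "{f :: nat \<Rightarrow> real. summable (\<lambda>i. (f i)\<^sup>2)}"
  morphisms coord Abs_ell2
  by (rule exI[of _ "\<lambda>_. 0"]) simp

setup_lifting type_definition_ell2

lemma summable_coord_square: "summable (\<lambda>i. (coord x i)\<^sup>2)"
  using coord[of x] by simp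

lemma summable_square_add:
  fixes f g :: "nat \<Rightarrow> real"
  assumes "summable (\<lambda>i. (f i)\<^sup>2)" and "summable (\<lambda>i. (g i)\<^sup>2)"
  shows "summable (\<lambda>i. (f i + g i)\<^sup>2)"
proof (rule summable_comparison_test)
  show "summable (\<lambda>i. 2 * (f i)\<^sup>2 + 2 * (g i)\<^sup>2)"
    using assms by (intro summable_add summable_mult)
  have "(a + b)\<^sup>2 \<le> 2 * a\<^sup>2 + 2 * b\<^sup>2" for a b :: real
    using zero_le_power2[of "a - b"] by (simp add: power2_eq_square algebra_simps)
  then show "\<exists>N. \<forall>n\<ge>N. norm ((f n + g n)\<^sup>2) \<le> 2 * (f n)\<^sup>2 + 2 * (g n)\<^sup>2"
    by simp
qed

lemma summable_square_scale:
  fixes f :: "nat \<Rightarrow> real"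
  assumes "summable (\<lambda>i. (f i)\<^sup>2)"
  shows "summable (\<lambda>i. (c * f i)\<^sup>2)"
  using assms by (simp add: power_mult_distrib summable_mult)

lemma summable_coord_mult: "summable (\<lambda>i. coord x i * coord y i)"
proof (rule summable_comparison_test)
  show "summable (\<lambda>i. (coord x i)\<^sup>2 + (coord y i)\<^sup>2)"
    by (intro summable_add summable_coord_square)
  have "\<bar>a * b\<bar> \<le> a\<^sup>2 + b\<^sup>2" for a b :: real
  proof -
    have "2 * \<bar>a * b\<bar> \<le> a\<^sup>2 + b\<^sup>2"
      using zero_le_power2[of "\<bar>a\<bar> - \<bar>b\<bar>"] by (simp add: power2_diff abs_mult)
    then show ?thesis
      using abs_ge_zero[of "a * b"] by linarith
  qed
  then show "\<exists>N. \<forall>n\<ge>N. norm (coord x n * coord y n) \<le> (coord x n)\<^sup>2 + (coord y n)\<^sup>2"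
    by simp
qed

instantiation ell2 :: real_vector
begin

lift_definition zero_ell2 :: ell2 is "\<lambda>_. 0"
  by simp

lift_definition plus_ell2 :: "ell2 \<Rightarrow> ell2 \<Rightarrow> ell2" is "\<lambda>f g i. f i + g i"
  by (rule summable_square_add)

lift_definition uminus_ell2 :: "ell2 \<Rightarrow> ell2" is "\<lambda>f i. - f i"
  by simp

lift_definition minus_ell2 :: "ell2 \<Rightarrow> ell2 \<Rightarrow> ell2" is "\<lambda>f g i. f i - g i"
  subgoal for f g
    using summable_square_add[of f "\<lambda>i. - g i"] by simp
  done

lift_definition scaleR_ell2 :: "real \<Rightarrow> ell2 \<Rightarrow> ell2" is "\<lambda>c f i. c * f i"
  by (rule summable_square_scale)

instance
  by standard (transfer; simp add: fun_eq_iff algebra_simps)+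

end

instantiation ell2 :: real_inner
begin

definition inner_ell2 :: "ell2 \<Rightarrow> ell2 \<Rightarrow> real"
  where "inner_ell2 x y = (\<Sum>i. coord x i * coord y i)"

definition norm_ell2 :: "ell2 \<Rightarrow> real"
  where "norm_ell2 x = sqrt (inner x x)"

definition sgn_ell2 :: "ell2 \<Rightarrow> ell2"
  where "sgn_ell2 x = x /\<^sub>R norm x"

definition dist_ell2 :: "ell2 \<Rightarrow> ell2 \<Rightarrow> real"
  where "dist_ell2 x y = norm (x - y)"

definition uniformity_ell2 :: "(ell2 \<times> ell2) filter"
  where "uniformity_ell2 = (INF e\<in>{0<..}. principal {(x, y). dist x y < e})"

definition open_ell2 :: "ell2 set \<Rightarrow> bool"
  where "open_ell2 U \<longleftrightarrow> (\<forall>x\<in>U. eventually (\<lambda>(x', y). x' = x \<longrightarrow> y \<in> U) uniformity)"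

instance
proof
  fix x y z :: ell2 and r :: real
  show "inner x y = inner y x"
    by (simp add: inner_ell2_def mult.commute)
  show "inner (x + y) z = inner x z + inner y z"
    using suminf_add[OF summable_coord_mult[of x z] summable_coord_mult[of y z]]
    by (simp add: inner_ell2_def plus_ell2.rep_eq algebra_simps)
  show "inner (r *\<^sub>R x) y = r * inner x y"
    using suminf_mult[OF summable_coord_mult[of x y], of r]
    by (simp add: inner_ell2_def scaleR_ell2.rep_eq mult.assoc)
  show "0 \<le> inner x x"
    unfolding inner_ell2_def by (intro suminf_nonneg summable_coord_mult) simp
  have "inner x x = 0 \<longleftrightarrow> (\<forall>i. coord x i * coord x i = 0)"
    unfolding inner_ell2_def by (intro suminf_eq_zero_iff summable_coord_mult) simp
  also have "\<dots> \<longleftrightarrow> x = 0"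
    by (simp add: coord_inject[symmetric] zero_ell2.rep_eq fun_eq_iff)
  finally show "inner x x = 0 \<longleftrightarrow> x = 0" .
qed (rule norm_ell2_def sgn_ell2_def dist_ell2_def uniformity_ell2_def open_ell2_def)+

end

lemma norm_ell2_square: "(norm x)\<^sup>2 = (\<Sum>i. (coord x i)\<^sup>2)"
  unfolding power2_norm_eq_inner inner_ell2_def by (simp add: power2_eq_square)

lemma sum_coord_square_le: "(\<Sum>i<k. (coord x i)\<^sup>2) \<le> (norm x)\<^sup>2"
  unfolding norm_ell2_square by (intro sum_le_suminf summable_coord_square) auto

lemma abs_coord_le_norm: "\<bar>coord x i\<bar> \<le> norm x"
proof (rule power2_le_imp_le)
  have "(coord x i)\<^sup>2 \<le> (\<Sum>j<Suc i. (coord x j)\<^sup>2)"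
    by (rule member_le_sum) auto
  also have "\<dots> \<le> (norm x)\<^sup>2"
    by (rule sum_coord_square_le)
  finally show "\<bar>coord x i\<bar>\<^sup>2 \<le> (norm x)\<^sup>2"
    by simp
qed simp

instance ell2 :: complete_space
proof
  fix X :: "nat \<Rightarrow> ell2"
  assume X: "Cauchy X"
  have "Cauchy (\<lambda>n. coord (X n) i)" for i
  proof (rule metric_CauchyI)
    fix e :: real
    assume "0 < e"
    with X obtain M where M: "\<And>m n. m \<ge> M \<Longrightarrow> n \<ge> M \<Longrightarrow> dist (X m) (X n) < e"
      unfolding Cauchy_def by blast
    have "dist (coord (X m) i) (coord (X n) i) < e" if "m \<ge> M" "n \<ge> M" for m n
      using abs_coord_le_norm[of "X m - X n" i] M[OF that]
      by (simp add: dist_norm minus_ell2.rep_eq)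
    then show "\<exists>M. \<forall>m\<ge>M. \<forall>n\<ge>M. dist (coord (X m) i) (coord (X n) i) < e"
      by blast
  qed
  then have "\<exists>l. (\<lambda>n. coord (X n) i) \<longlonglongrightarrow> l" for i
    using Cauchy_convergent convergent_def by blast
  then obtain l where l: "\<And>i. (\<lambda>n. coord (X n) i) \<longlonglongrightarrow> l i"
    by metis
  have bound: "\<exists>M. \<forall>n\<ge>M. \<forall>k. (\<Sum>i<k. (l i - coord (X n) i)\<^sup>2) \<le> e\<^sup>2" if "0 < e" for e
  proof -
    from X \<open>0 < e\<close> obtain M where M: "\<And>m n. m \<ge> M \<Longrightarrow> n \<ge> M \<Longrightarrow> dist (X m) (X n) < e"
      unfolding Cauchy_def by blast
    have "(\<Sum>i<k. (l i - coord (X n) i)\<^sup>2) \<le> e\<^sup>2" if "n \<ge> M" for n k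
    proof (rule LIMSEQ_le_const2)
      show "(\<lambda>m. \<Sum>i<k. (coord (X m) i - coord (X n) i)\<^sup>2)
              \<longlonglongrightarrow> (\<Sum>i<k. (l i - coord (X n) i)\<^sup>2)"
        by (intro tendsto_intros l)
      have "(\<Sum>i<k. (coord (X m) i - coord (X n) i)\<^sup>2) \<le> e\<^sup>2" if "m \<ge> M" for m
      proof -
        have "(\<Sum>i<k. (coord (X m) i - coord (X n) i)\<^sup>2) \<le> (norm (X m - X n))\<^sup>2"
          using sum_coord_square_le[of "X m - X n" k] by (simp add: minus_ell2.rep_eq)
        also have "\<dots> \<le> e\<^sup>2"
          using M[OF \<open>m \<ge> M\<close> \<open>n \<ge> M\<close>] by (intro power_mono) (auto simp: dist_norm)
        finally show ?thesis .
      qed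
      then show "\<exists>N. \<forall>m\<ge>N. (\<Sum>i<k. (coord (X m) i - coord (X n) i)\<^sup>2) \<le> e\<^sup>2"
        by blast
    qed
    then show ?thesis
      by blast
  qed
  have summable_diff: "\<exists>M. \<forall>n\<ge>M. summable (\<lambda>i. (l i - coord (X n) i)\<^sup>2) \<and>
      (\<Sum>i. (l i - coord (X n) i)\<^sup>2) \<le> e\<^sup>2" if e: "0 < e" for e
  proof -
    obtain M where M: "\<And>n k. n \<ge> M \<Longrightarrow> (\<Sum>i<k. (l i - coord (X n) i)\<^sup>2) \<le> e\<^sup>2"
      using bound[OF e] by blast
    have "summable (\<lambda>i. (l i - coord (X n) i)\<^sup>2) \<and> (\<Sum>i. (l i - coord (X n) i)\<^sup>2) \<le> e\<^sup>2"
      if "n \<ge> M" for n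
    proof
      show "summable (\<lambda>i. (l i - coord (X n) i)\<^sup>2)"
        by (rule summableI_nonneg_bounded[where x = "e\<^sup>2"]) (use M[OF that] in auto)
      then show "(\<Sum>i. (l i - coord (X n) i)\<^sup>2) \<le> e\<^sup>2"
        by (rule suminf_le_const) (rule M[OF that])
    qed
    then show ?thesis
      by blast
  qed
  obtain n0 where "summable (\<lambda>i. (l i - coord (X n0) i)\<^sup>2)"
    using summable_diff[of 1] by auto
  from summable_square_add[OF this summable_coord_square[of "X n0"]]
  have "summable (\<lambda>i. (l i)\<^sup>2)"
    by simp
  then have coord_L: "coord (Abs_ell2 l) = l"
    by (simp add: Abs_ell2_inverse)
  have "X \<longlonglongrightarrow> Abs_ell2 l"
  proof (rule metric_LIMSEQ_I)
    fix r :: real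
    assume "0 < r"
    then obtain M where M: "\<And>n. n \<ge> M \<Longrightarrow> (\<Sum>i. (l i - coord (X n) i)\<^sup>2) \<le> (r / 2)\<^sup>2"
      using summable_diff[of "r / 2"] by auto
    have "dist (X n) (Abs_ell2 l) < r" if "n \<ge> M" for n
    proof -
      have "(norm (Abs_ell2 l - X n))\<^sup>2 \<le> (r / 2)\<^sup>2"
        using M[OF that] by (simp add: norm_ell2_square minus_ell2.rep_eq coord_L)
      then have "norm (Abs_ell2 l - X n) \<le> r / 2"
        by (rule power2_le_imp_le) (use \<open>0 < r\<close> in simp)
      then show ?thesis
        using \<open>0 < r\<close> by (simp add: dist_norm norm_minus_commute)
    qed
    then show "\<exists>N. \<forall>n\<ge>N. dist (X n) (Abs_ell2 l) < r"
      by blast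
  qed
  then show "convergent X"
    by (rule convergentI)
qed


section \<open>Hilbert spaces as complete subspaces, and their operators\<close>

definition hilbert_subspace :: "'a::real_inner set \<Rightarrow> bool"
  where "hilbert_subspace X \<longleftrightarrow> subspace X \<and> complete X"

definition finite_dim_subspace :: "'a::real_vector set \<Rightarrow> bool"
  where "finite_dim_subspace V \<longleftrightarrow> (\<exists>B. finite B \<and> V = span B)"

definition bounded_linear_between ::
    "'a::real_normed_vector set \<Rightarrow> 'b::real_normed_vector set \<Rightarrow> ('a \<Rightarrow> 'b) \<Rightarrow> bool"
  where "bounded_linear_between X Y T \<longleftrightarrow>
    T ` X \<subseteq> Y \<and>
    (\<forall>x\<in>X. \<forall>y\<in>X. T (x + y) = T x + T y) \<and>
    (\<forall>c. \<forall>x\<in>X. T (c *\<^sub>R x) = c *\<^sub>R T x) \<and>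
    (\<exists>K. \<forall>x\<in>X. norm (T x) \<le> K * norm x)"

definition nullspace_on :: "'a::real_vector set \<Rightarrow> ('a \<Rightarrow> 'b::real_vector) \<Rightarrow> 'a set"
  where "nullspace_on X T = {x \<in> X. T x = 0}"

text \<open>Orthogonal projector onto \<open>V\<close>; well-defined when \<open>V\<close> is a complete subspace.\<close>

definition orth_projector :: "'a::real_inner set \<Rightarrow> 'a \<Rightarrow> 'a"
  where "orth_projector V x = (THE p. p \<in> V \<and> x - p \<in> V\<^sup>\<bottom>)"

definition least_squares_solution ::
    "'a::real_inner set \<Rightarrow> ('a \<Rightarrow> 'b::real_inner) \<Rightarrow> 'b \<Rightarrow> 'a \<Rightarrow> bool"
  where "least_squares_solution X T y x \<longleftrightarrow>
    x \<in> X \<and> (\<forall>z\<in>X. norm (T x - y) \<le> norm (T z - y))"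

text \<open>
  Moore-Penrose pseudoinverse of an operator with domain \<open>X\<close>; well-defined when \<open>X\<close> is a Hilbert
  space and the operator is bounded and has closed range, for instance finite rank.
\<close>

definition pseudoinverse ::
    "'a::real_inner set \<Rightarrow> ('a \<Rightarrow> 'b::real_inner) \<Rightarrow> 'b \<Rightarrow> 'a"
  where "pseudoinverse X T y =
    (THE x. least_squares_solution X T y x \<and>
            (\<forall>z. least_squares_solution X T y z \<longrightarrow> norm x \<le> norm z))"

definition weakly_tendsto_on :: "'a::real_inner set \<Rightarrow> (nat \<Rightarrow> 'a) \<Rightarrow> 'a \<Rightarrow> bool"
  where "weakly_tendsto_on X f l \<longleftrightarrow>
    (\<forall>y\<in>X. (\<lambda>n. inner (f n) y) \<longlonglongrightarrow> inner l y)"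

end

theory Submission
  imports Defs
begin

text \<open>
  The even coordinates carry the operator \<open>2L - I\<close> with \<open>L\<close> the left shift, the odd ones lie in the
  nullspace. Writing the even coordinates as \<open>2\<^sup>-\<^sup>k c\<^sub>k\<close>, the operator becomes
  \<open>2\<^sup>-\<^sup>k (c\<^sub>k\<^sub>+\<^sub>1 - c\<^sub>k)\<close>, whose nullspace in the even part consists of the constant \<open>c\<close>. If only
  \<open>c\<^sub>0, \<dots>, c\<^sub>N\<close> are available, fitting the first \<open>N + 1\<close> differences (the last one being \<open>0 - c\<^sub>N\<close>)
  forces the whole vector to be shifted by \<open>-c\<^sub>N\<^sub>+\<^sub>1\<close>. The exact solution has
  \<open>c = 1, -4, 1, -4, \<dots>\<close>, which alternates and is orthogonal to the constants in the weights
  \<open>4\<^sup>-\<^sup>k\<close>; the two values of the shift give two weak limits. Strong convergence is destroyed by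
  tying the last even coordinate, which tends to \<open>0\<close> like \<open>2\<^sup>-\<^sup>N\<close>, to an odd coordinate enlarged by
  \<open>2\<^sup>N\<close>: the solution then carries a component of constant size along a moving basis vector.
\<close>

section \<open>Pseudoinverses of projected operators\<close>

lemma orth_projector_eqI:
  assumes "subspace V" and "p \<in> V" and "x - p \<in> V\<^sup>\<bottom>"
  shows "orth_projector V x = p"
  unfolding orth_projector_def
proof (rule the_equality)
  show "p \<in> V \<and> x - p \<in> V\<^sup>\<bottom>"
    using assms by blast
next
  fix q
  assume q: "q \<in> V \<and> x - q \<in> V\<^sup>\<bottom>"
  have "p - q \<in> V"
    using assms q by (simp add: subspace_diff)
  with assms q have "(x - q) \<bullet> (p - q) = 0" "(x - p) \<bullet> (p - q) = 0"
    by (auto simp: orthogonal_comp_def orthogonal_def inner_commute)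
  then have "(p - q) \<bullet> (p - q) = 0"
    by (simp add: inner_diff_left)
  then show "q = p"
    by simp
qed

text \<open>Reduces a pseudoinverse to checking a candidate: the normal equations on
  \<open>V\<close> give minimality of the residual, and orthogonality to the null vectors in
  \<open>V\<close> selects the minimum-norm solution.\<close>

lemma pseudoinverse_projected_eqI:
  fixes A :: "'a::real_inner \<Rightarrow> 'b::real_inner"
  assumes A: "linear A" and V: "subspace V" "V \<subseteq> X"
    and proj: "\<And>z. z \<in> X \<Longrightarrow> \<exists>p\<in>V. z - p \<in> V\<^sup>\<bottom>"
    and x: "x \<in> V"
    and residual: "\<And>z. z \<in> V \<Longrightarrow> (A x - y) \<bullet> A z = 0"
    and minimal: "\<And>z. z \<in> V \<Longrightarrow> A z = 0 \<Longrightarrow> x \<bullet> z = 0"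
  shows "pseudoinverse X (A \<circ> orth_projector V) y = x"
proof -
  let ?P = "orth_projector V"
  have P: "?P z \<in> V" "z - ?P z \<in> V\<^sup>\<bottom>" if "z \<in> X" for z
    using proj[OF that] orth_projector_eqI[OF V(1)] by metis+
  have "x - x \<in> V\<^sup>\<bottom>"
    by (simp add: subspace_0 subspace_orthogonal_comp)
  then have Px: "?P x = x"
    using orth_projector_eqI[OF V(1) x] by blast
  have pythagoras: "(norm (A (?P z) - y))\<^sup>2 = (norm (A x - y))\<^sup>2 + (norm (A (?P z - x)))\<^sup>2"
    if "z \<in> X" for z
  proof -
    have "(A x - y) \<bullet> A (?P z - x) = 0"
      using P(1)[OF that] x V(1) by (intro residual) (simp add: subspace_diff)
    moreover have "A (?P z) - y = (A x - y) + A (?P z - x)"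
      by (simp add: linear_diff[OF A])
    ultimately show ?thesis
      by (simp only: power2_norm_eq_inner inner_add_left inner_add_right inner_commute)
  qed
  have lsq_x: "least_squares_solution X (A \<circ> ?P) y x"
    unfolding least_squares_solution_def
  proof (intro conjI ballI)
    show "x \<in> X"
      using x V by blast
    fix z
    assume "z \<in> X"
    have "norm (A x - y) \<le> norm (A (?P z) - y)"
      by (rule power2_le_imp_le) (simp_all add: pythagoras[OF \<open>z \<in> X\<close>])
    then show "norm ((A \<circ> ?P) x - y) \<le> norm ((A \<circ> ?P) z - y)"
      by (simp add: Px)
  qed
  \<comment> \<open>A second Pythagoras: every least-squares solution differs from \<open>x\<close>
    by a vector orthogonal to \<open>x\<close>. This yields both norm minimality and
    uniqueness.\<close>
  have split: "(norm z)\<^sup>2 = (norm x)\<^sup>2 + (norm (z - x))\<^sup>2"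
    if z: "least_squares_solution X (A \<circ> ?P) y z" for z
  proof -
    have "z \<in> X"
      using z by (simp add: least_squares_solution_def)
    have "norm ((A \<circ> ?P) z - y) \<le> norm ((A \<circ> ?P) x - y)"
      using z lsq_x unfolding least_squares_solution_def by blast
    then have "norm (A (?P z) - y) \<le> norm (A x - y)"
      by (simp add: Px)
    then have "(norm (A (?P z) - y))\<^sup>2 \<le> (norm (A x - y))\<^sup>2"
      by (intro power_mono) auto
    then have "A (?P z - x) = 0"
      using pythagoras[OF \<open>z \<in> X\<close>] by simp
    then have "x \<bullet> (?P z - x) = 0"
      using P(1)[OF \<open>z \<in> X\<close>] x V(1) by (intro minimal) (simp add: subspace_diff)
    moreover have "x \<bullet> (z - ?P z) = 0"
      using P(2)[OF \<open>z \<in> X\<close>] x by (auto simp: orthogonal_comp_def orthogonal_def)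
    ultimately have "x \<bullet> (z - x) = 0"
      by (simp add: inner_diff_right)
    then show ?thesis
      by (simp add: power2_norm_eq_inner inner_diff_left inner_diff_right inner_commute)
  qed
  show ?thesis
    unfolding pseudoinverse_def
  proof (rule the_equality)
    have "norm x \<le> norm z" if "least_squares_solution X (A \<circ> ?P) y z" for z
      by (rule power2_le_imp_le) (simp_all add: split[OF that])
    then show "least_squares_solution X (A \<circ> ?P) y x \<and>
        (\<forall>z. least_squares_solution X (A \<circ> ?P) y z \<longrightarrow> norm x \<le> norm z)"
      using lsq_x by blast
  next
    fix z
    assume z: "least_squares_solution X (A \<circ> ?P) y z \<and>
        (\<forall>z'. least_squares_solution X (A \<circ> ?P) y z' \<longrightarrow> norm z \<le> norm z')"
    then have "norm z \<le> norm x"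
      using lsq_x by blast
    then have "(norm z)\<^sup>2 \<le> (norm x)\<^sup>2"
      by (rule power_mono) (rule norm_ge_zero)
    moreover have "(norm z)\<^sup>2 = (norm x)\<^sup>2 + (norm (z - x))\<^sup>2"
      using z by (intro split) blast
    ultimately show "z = x"
      by simp
  qed
qed


section \<open>Unit vectors and truncations in the sequence space\<close>

lemma ell2_eqI: "(\<And>i. coord x i = coord y i) \<Longrightarrow> x = y"
  by (simp add: coord_inject[symmetric] fun_eq_iff)

lemma inner_ell2_eq_0I: "(\<And>i. coord x i * coord y i = 0) \<Longrightarrow> x \<bullet> y = 0"
  by (simp only: inner_ell2_def suminf_zero)

lemma coord_sum: "coord (\<Sum>i\<in>I. f i) k = (\<Sum>i\<in>I. coord (f i) k)"
  by (induction I rule: infinite_finite_induct) (simp_all add: zero_ell2.rep_eq plus_ell2.rep_eq)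

text \<open>Equivalently, the unit vectors tend weakly to 0; this hides the moving component from
  weak limits.\<close>

lemma coord_tendsto_0: "(\<lambda>i. coord x i) \<longlonglongrightarrow> 0"
proof -
  have "(\<lambda>i. sqrt ((coord x i)\<^sup>2)) \<longlonglongrightarrow> sqrt 0"
    by (intro tendsto_real_sqrt summable_LIMSEQ_zero summable_coord_square)
  then show ?thesis
    by (simp add: tendsto_rabs_zero_iff)
qed

lift_definition unit_ell2 :: "nat \<Rightarrow> ell2" is "\<lambda>j i. if i = j then 1 else 0"
  by (rule summable_finite[of "{j}" for j]) auto

lemma inner_unit_ell2: "x \<bullet> unit_ell2 j = coord x j"
proof -
  have "(\<lambda>i. coord x i * coord (unit_ell2 j) i) sums (\<Sum>i\<in>{j}. coord x i * coord (unit_ell2 j) i)"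
    by (rule sums_finite) (auto simp: unit_ell2.rep_eq)
  then show ?thesis
    by (simp add: inner_ell2_def sums_iff unit_ell2.rep_eq)
qed

lift_definition trunc :: "nat \<Rightarrow> ell2 \<Rightarrow> ell2" is "\<lambda>m f i. if i < m then f i else 0"
  subgoal for m f
    by (rule summable_finite[of "{..<m}"]) auto
  done

lemma trunc_eq_sum: "trunc m x = (\<Sum>i<m. coord x i *\<^sub>R unit_ell2 i)"
  by (rule ell2_eqI)
    (simp add: coord_sum trunc.rep_eq unit_ell2.rep_eq scaleR_ell2.rep_eq if_distrib cong: if_cong)

text \<open>The squared error is the tail of a convergent series.\<close>

lemma trunc_tendsto: "(\<lambda>m. trunc m x) \<longlonglongrightarrow> x"
proof -
  let ?f = "\<lambda>i. (coord x i)\<^sup>2"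
  have "(norm (x - trunc m x))\<^sup>2 = (\<Sum>i. ?f i) - (\<Sum>i<m. ?f i)" for m
  proof -
    have "(\<lambda>i. if i < m then ?f i else 0) sums (\<Sum>i<m. ?f i)"
      using sums_If_finite_set[of "{..<m}" ?f] by simp
    from sums_diff[OF summable_sums[OF summable_coord_square] this]
    have "(\<lambda>i. ?f i - (if i < m then ?f i else 0)) sums ((\<Sum>i. ?f i) - (\<Sum>i<m. ?f i))" .
    moreover have "(\<lambda>i. ?f i - (if i < m then ?f i else 0)) = (\<lambda>i. (coord (x - trunc m x) i)\<^sup>2)"
      by (auto simp: minus_ell2.rep_eq trunc.rep_eq)
    ultimately show ?thesis
      by (simp add: norm_ell2_square sums_iff)
  qed
  moreover have "(\<lambda>m. sqrt ((\<Sum>i. ?f i) - (\<Sum>i<m. ?f i))) \<longlonglongrightarrow> sqrt ((\<Sum>i. ?f i) - (\<Sum>i. ?f i))"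
    by (intro tendsto_intros summable_LIMSEQ summable_coord_square)
  ultimately have "(\<lambda>m. norm (x - trunc m x)) \<longlonglongrightarrow> 0"
    by (metis (no_types, lifting) ext diff_self norm_ge_zero real_sqrt_unique real_sqrt_zero)
  then show ?thesis
    by (simp add: LIMSEQ_iff norm_minus_commute)
qed


section \<open>The operator and the exact solution\<close>

text \<open>Offset 0 reads off the even coordinates, offset 2 their left shift.\<close>

lift_definition stride2 :: "nat \<Rightarrow> ell2 \<Rightarrow> ell2" is "\<lambda>m f k. f (2 * k + m)"
  subgoal for m f
    using summable_reindex[of "\<lambda>i. (f i)\<^sup>2" "\<lambda>k. 2 * k + m"] by (simp add: inj_on_def o_def)
  done

lemma norm_stride2_le: "norm (stride2 m x) \<le> norm x"
proof (rule power2_le_imp_le)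
  show "(norm (stride2 m x))\<^sup>2 \<le> (norm x)\<^sup>2"
    using suminf_reindex_mono[OF summable_coord_square, of "\<lambda>k. 2 * k + m" x]
    by (simp add: norm_ell2_square stride2.rep_eq inj_on_def o_def)
qed simp

definition diff_op :: "ell2 \<Rightarrow> ell2"
  where "diff_op x = 2 *\<^sub>R stride2 2 x - stride2 0 x"

lemma coord_diff_op: "coord (diff_op x) k = 2 * coord x (2 * k + 2) - coord x (2 * k)"
  by (simp add: diff_op_def minus_ell2.rep_eq scaleR_ell2.rep_eq stride2.rep_eq)

lemma linear_diff_op: "linear diff_op"
  by (intro linearI ell2_eqI)
    (simp_all add: coord_diff_op plus_ell2.rep_eq scaleR_ell2.rep_eq algebra_simps)

lemma norm_diff_op_le: "norm (diff_op x) \<le> 3 * norm x"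
proof -
  have "norm (diff_op x) \<le> norm (2 *\<^sub>R stride2 2 x) + norm (stride2 0 x)"
    unfolding diff_op_def by (rule norm_triangle_ineq4)
  then show ?thesis
    using norm_stride2_le[of 2 x] norm_stride2_le[of 0 x] by simp
qed

section \<open>The nullspace in the even coordinates and a solution orthogonal to it\<close>

lemma coord_nullspace_diff_op:
  assumes "diff_op z = 0"
  shows "2 * coord z (2 * k + 2) = coord z (2 * k)"
  using arg_cong[OF assms, of "\<lambda>x. coord x k"] by (simp add: coord_diff_op zero_ell2.rep_eq)

text \<open>Spans the even part of the nullspace: the constant sequence 1 in rescaled
  coordinates.\<close>

lift_definition geo :: ell2 is "\<lambda>i. if even i then (1/2) ^ (i div 2) else 0"
proof (rule summable_comparison_test[OF _ summable_geometric[of "1/2 :: real"]])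
  show "\<exists>N. \<forall>n\<ge>N. norm ((if even n then (1/2) ^ (n div 2) else 0 :: real)\<^sup>2) \<le> (1/2) ^ n"
    by (auto simp flip: power_mult)
qed simp

text \<open>The value -4 is forced by \<open>1 + (1/4) * (-4) = 0\<close>, the cancellation of a
  consecutive pair in the weights \<open>4^-k\<close>. Both values are nonzero, so either shift
  moves the solution.\<close>

definition alt :: "nat \<Rightarrow> real"
  where "alt k = (if even k then 1 else -4)"

lift_definition sol :: ell2 is "\<lambda>i. if even i then (1/2) ^ (i div 2) * alt (i div 2) else 0"
proof (rule summable_comparison_test[OF _ summable_mult[OF summable_geometric[of "1/2 :: real"]]])
  show "\<exists>N. \<forall>n\<ge>N. norm ((if even n then (1/2) ^ (n div 2) * alt (n div 2) else 0 :: real)\<^sup>2)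
      \<le> 16 * (1/2) ^ n"
    by (auto simp: alt_def power_mult_distrib simp flip: power_mult)
qed simp

text \<open>Each block of four coordinates contributes 0, so the partial sums along multiples of 4
  vanish, and they converge to the inner product.\<close>

lemma sol_orth_nullspace:
  assumes "diff_op z = 0"
  shows "sol \<bullet> z = 0"
proof -
  let ?f = "\<lambda>i. coord sol i * coord z i"
  have null: "2 * coord z (2 * k + 2) = coord z (2 * k)" for k
    using coord_nullspace_diff_op[OF assms] .
  have "(\<Sum>i<4 * m. ?f i) = 0" for m
  proof (induction m)
    case (Suc m)
    have "4 * Suc m = Suc (Suc (Suc (Suc (4 * m))))"
      by simp
    moreover have "coord sol (4 * m) = (1/2) ^ (2 * m)" "coord sol (Suc (4 * m)) = 0"
        "coord sol (Suc (Suc (4 * m))) = -2 * (1/2) ^ (2 * m)"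
        "coord sol (Suc (Suc (Suc (4 * m)))) = 0"
      by (simp_all add: sol.rep_eq alt_def)
    moreover have "2 * coord z (Suc (Suc (4 * m))) = coord z (4 * m)"
      using null[of "2 * m"] by simp
    ultimately show ?case
      using Suc.IH by (simp only: sum.lessThan_Suc) (simp add: algebra_simps)
  qed simp
  moreover have "(\<lambda>m. \<Sum>i<4 * m. ?f i) \<longlonglongrightarrow> suminf ?f"
    using LIMSEQ_subseq_LIMSEQ[OF summable_LIMSEQ[OF summable_coord_mult[of sol z]],
        of "\<lambda>m. 4 * m"]
    by (simp add: strict_mono_def o_def)
  ultimately show ?thesis
    by (simp add: inner_ell2_def LIMSEQ_const_iff)
qed


section \<open>The subspaces and the projected solutions\<close>

text \<open>Coordinates below \<open>2 * n + 2\<close> are free; the next two are tied, the factor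
  compensating the decay of the last even coordinate.\<close>

definition approx :: "nat \<Rightarrow> ell2 set"
  where "approx n = {x. (\<forall>i>2 * n + 3. coord x i = 0) \<and>
    coord x (2 * n + 3) = 2 ^ (n + 1) * coord x (2 * n + 2)}"

definition link :: "nat \<Rightarrow> ell2"
  where "link n = unit_ell2 (2 * n + 2) + 2 ^ (n + 1) *\<^sub>R unit_ell2 (2 * n + 3)"

lemma subspace_approx: "subspace (approx n)"
  by (auto simp: subspace_def approx_def zero_ell2.rep_eq plus_ell2.rep_eq scaleR_ell2.rep_eq
      algebra_simps)

text \<open>The old tied pair becomes free, and the new tie reads \<open>0 = 0\<close> on the
  smaller space.\<close>

lemma approx_mono: "approx n \<subseteq> approx (Suc n)"
  by (auto simp: approx_def)

lemma coord_link:
  "coord (link n) i = (if i = 2 * n + 2 then 1 else if i = 2 * n + 3 then 2 ^ (n + 1) else 0)"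
  by (simp add: link_def plus_ell2.rep_eq scaleR_ell2.rep_eq unit_ell2.rep_eq)

lemma link_in_approx: "link n \<in> approx n"
  by (simp add: approx_def coord_link)

lemma trunc_in_approx: "trunc (2 * n + 2) x \<in> approx n"
  by (simp add: approx_def trunc.rep_eq)

lemma approx_decomp:
  assumes "x \<in> approx n"
  shows "x = trunc (2 * n + 2) x + coord x (2 * n + 2) *\<^sub>R link n"
proof (rule ell2_eqI)
  fix i
  consider "i < 2 * n + 2" | "i = 2 * n + 2" | "i = 2 * n + 3" | "i > 2 * n + 3"
    by linarith
  then show "coord x i = coord (trunc (2 * n + 2) x + coord x (2 * n + 2) *\<^sub>R link n) i"
    using assms
    by cases (simp_all add: approx_def plus_ell2.rep_eq scaleR_ell2.rep_eq trunc.rep_eq coord_link)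
qed

lemma finite_dim_approx: "finite_dim_subspace (approx n)"
proof -
  let ?B = "insert (link n) (unit_ell2 ` {..<2 * n + 2})"
  have "approx n \<subseteq> span ?B"
  proof
    fix x
    assume "x \<in> approx n"
    have "trunc (2 * n + 2) x + coord x (2 * n + 2) *\<^sub>R link n \<in> span ?B"
      unfolding trunc_eq_sum by (intro span_add span_sum span_scale span_base) auto
    then show "x \<in> span ?B"
      using approx_decomp[OF \<open>x \<in> approx n\<close>] by simp
  qed
  moreover have "?B \<subseteq> approx n"
    using link_in_approx by (auto simp: approx_def unit_ell2.rep_eq)
  then have "span ?B \<subseteq> approx n"
    by (rule span_minimal) (rule subspace_approx)
  ultimately show ?thesis
    unfolding finite_dim_subspace_def by (intro exI[of _ ?B]) auto
qed

text \<open>The space is the orthogonal sum of the free coordinates and the line through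
  \<open>link n\<close>, so the projection is a truncation plus a one-dimensional
  projection.\<close>

lemma approx_projection_exists: "\<exists>p\<in>approx n. z - p \<in> (approx n)\<^sup>\<bottom>"
proof
  define a where "a = (z \<bullet> link n) / (link n \<bullet> link n)"
  let ?p = "trunc (2 * n + 2) z + a *\<^sub>R link n"
  show "?p \<in> approx n"
    by (intro subspace_add subspace_scale subspace_approx link_in_approx trunc_in_approx)
  have disjoint: "trunc (2 * n + 2) x \<bullet> link n = 0" for x
    by (rule inner_ell2_eq_0I) (simp add: trunc.rep_eq coord_link)
  have "link n \<noteq> 0"
    using coord_link[of n "2 * n + 2"] by (auto simp: zero_ell2.rep_eq)
  then have "(z - ?p) \<bullet> link n = 0"
    unfolding a_def inner_diff_left inner_add_left disjoint by simp
  moreover have "(z - ?p) \<bullet> trunc (2 * n + 2) x = 0" for x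
    by (rule inner_ell2_eq_0I)
      (simp add: minus_ell2.rep_eq plus_ell2.rep_eq scaleR_ell2.rep_eq trunc.rep_eq coord_link)
  ultimately have "(z - ?p) \<bullet> x = 0" if "x \<in> approx n" for x
    by (subst approx_decomp[OF that]) (simp add: inner_add_right)
  then show "z - ?p \<in> (approx n)\<^sup>\<bottom>"
    by (simp add: orthogonal_comp_def orthogonal_def inner_commute)
qed

lemma closure_approx: "closure (\<Union>n. approx n) = UNIV"
proof -
  have "x \<in> closure (\<Union>n. approx n)" for x
    unfolding closure_sequential
  proof (intro exI conjI allI)
    show "trunc (2 * n + 2) x \<in> (\<Union>n. approx n)" for n
      using trunc_in_approx by blast
    show "(\<lambda>n. trunc (2 * n + 2) x) \<longlonglongrightarrow> x"
      using LIMSEQ_subseq_LIMSEQ[OF trunc_tendsto[of x], of "\<lambda>n. 2 * n + 2"]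
      by (simp add: strict_mono_def o_def)
  qed
  then show ?thesis
    by blast
qed

section \<open>Explicit projected solutions\<close>

definition shifted :: "real \<Rightarrow> ell2"
  where "shifted c = sol - c *\<^sub>R geo"

lemma coord_shifted:
  "coord (shifted c) i = (if even i then (1/2) ^ (i div 2) * (alt (i div 2) - c) else 0)"
  by (simp add: shifted_def minus_ell2.rep_eq scaleR_ell2.rep_eq sol.rep_eq geo.rep_eq
      algebra_simps)

text \<open>The added odd entry is what the tie demands: \<open>2 ^ (n + 1)\<close> times the last
  even coordinate. Its modulus is always 5.\<close>

definition proj_sol :: "nat \<Rightarrow> ell2"
  where "proj_sol n = trunc (2 * n + 4) (shifted (alt n)) + (alt (n + 1) - alt n) *\<^sub>R unit_ell2 (2 * n + 3)"

lemma coord_proj_sol: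
  "coord (proj_sol n) i = (if i < 2 * n + 4 then coord (shifted (alt n)) i else 0) +
    (if i = 2 * n + 3 then alt (n + 1) - alt n else 0)"
  by (simp add: proj_sol_def plus_ell2.rep_eq scaleR_ell2.rep_eq trunc.rep_eq unit_ell2.rep_eq)

lemma proj_sol_in_approx: "proj_sol n \<in> approx n"
proof -
  have "coord (proj_sol n) (2 * n + 2) = (1/2) ^ (n + 1) * (alt (n + 1) - alt n)"
    by (simp add: coord_proj_sol coord_shifted)
  moreover have "coord (proj_sol n) (2 * n + 3) = alt (n + 1) - alt n"
    by (simp add: coord_proj_sol coord_shifted)
  ultimately show ?thesis
    by (auto simp: approx_def coord_proj_sol power_one_over)
qed

text \<open>Before the cut the shift is invisible because \<open>geo\<close> is a null vector; only
  the last difference depends on the size of the shift.\<close>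

lemma coord_diff_op_proj_sol:
  assumes "k \<le> n + 1"
  shows "coord (diff_op (proj_sol n)) k = coord (diff_op sol) k"
proof (cases "k = n + 1")
  \<comment> \<open>Here coordinate \<open>2 * n + 4\<close> is cut off, so the shift has to be
    \<open>alt (n + 2)\<close>, which equals \<open>alt n\<close> by periodicity.\<close>
  case True
  then show ?thesis
    by (simp add: coord_diff_op coord_proj_sol coord_shifted sol.rep_eq alt_def)
next
  case False
  with assms have "k < n + 1"
    by simp
  moreover have "2 * k \<noteq> 2 * n + 3" "2 * k + 2 \<noteq> 2 * n + 3"
    by presburger+
  ultimately show ?thesis
    by (simp add: coord_diff_op coord_proj_sol coord_shifted sol.rep_eq field_simps)
qed

text \<open>The recursion for null vectors carries the zero at index \<open>2 * n + 4\<close> down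
  through all even indices.\<close>

lemma coord_approx_nullspace:
  assumes z: "z \<in> approx n" and "diff_op z = 0"
  shows "coord z (2 * k) = 0"
proof -
  have downward: "coord z (2 * (n + 2) - 2 * j) = 0" if "j \<le> n + 2" for j
    using that
  proof (induction j)
    case 0
    then show ?case
      using z by (simp add: approx_def)
  next
    case (Suc j)
    then have "2 * (n + 1 - j) + 2 = 2 * (n + 2) - 2 * j" "2 * (n + 1 - j) = 2 * (n + 2) - 2 * Suc j"
      by auto
    then show ?case
      using coord_nullspace_diff_op[OF \<open>diff_op z = 0\<close>, of "n + 1 - j"] Suc by simp
  qed
  have *: "coord z (2 * (n + 2) - 2 * (n + 2 - k)) = 0"
    by (intro downward diff_le_self)
  show ?thesis
  proof (cases "k \<le> n + 2")
    case True
    then have "2 * (n + 2) - 2 * (n + 2 - k) = 2 * k"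
      by arith
    with * show ?thesis
      by (simp only:)
  next
    case False
    with z show ?thesis
      by (simp add: approx_def)
  qed
qed

text \<open>The residual lives on indices above \<open>n + 1\<close>, where images of
  \<open>approx n\<close> vanish. Null vectors in \<open>approx n\<close> live on odd indices below
  \<open>2 * n + 3\<close>, where \<open>proj_sol n\<close> vanishes.\<close>

lemma pseudoinverse_diff_op: "pseudoinverse UNIV (diff_op \<circ> orth_projector (approx n)) (diff_op sol) = proj_sol n"
proof (rule pseudoinverse_projected_eqI)
  fix z
  assume z: "z \<in> approx n"
  show "(diff_op (proj_sol n) - diff_op sol) \<bullet> diff_op z = 0"
  proof (rule inner_ell2_eq_0I)
    fix k
    have "coord (diff_op z) k = 0" if "\<not> k \<le> n + 1"
      using z that by (simp add: coord_diff_op approx_def)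
    then show "coord (diff_op (proj_sol n) - diff_op sol) k * coord (diff_op z) k = 0"
      using coord_diff_op_proj_sol[of k n] by (cases "k \<le> n + 1") (simp_all add: minus_ell2.rep_eq)
  qed
  show "proj_sol n \<bullet> z = 0" if "diff_op z = 0"
  proof (rule inner_ell2_eq_0I)
    fix i
    note even0 = coord_approx_nullspace[OF z that]
    \<comment> \<open>The tie passes the vanishing of the last even coordinate to its odd
      partner.\<close>
    have "coord z (2 * n + 3) = 0"
      using z even0[of "n + 1"] by (simp add: approx_def)
    moreover have "coord (proj_sol n) i = 0" if "odd i" "i \<noteq> 2 * n + 3"
      using that by (simp add: coord_proj_sol coord_shifted)
    ultimately show "coord (proj_sol n) i * coord z i = 0"
      using even0[of "i div 2"] by (cases "even i"; cases "i = 2 * n + 3") auto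
  qed
qed (rule linear_diff_op subspace_approx subset_UNIV approx_projection_exists proj_sol_in_approx)+


section \<open>Limits of the projected solutions\<close>

text \<open>The truncated part converges in norm, while the moving unit vector has a fixed
  coefficient and tends weakly to 0.\<close>

lemma proj_sol_weak_limit:
  assumes r: "strict_mono r" and c: "\<And>n. alt (r n) = c"
  shows "weakly_tendsto_on X (proj_sol \<circ> r) (shifted c)"
  unfolding weakly_tendsto_on_def
proof
  fix y
  \<comment> \<open>The two values of \<open>alt\<close> sum to -3.\<close>
  have alt: "alt (Suc (r n)) = - 3 - c" for n
    using c[of n] by (auto simp: alt_def split: if_splits)
  have "(\<lambda>n. trunc (2 * r n + 4) (shifted c)) \<longlonglongrightarrow> shifted c"
    using LIMSEQ_subseq_LIMSEQ[OF trunc_tendsto[of "shifted c"], of "\<lambda>n. 2 * r n + 4"] r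
    by (simp add: strict_mono_def o_def)
  moreover have "(\<lambda>n. coord y (2 * r n + 3)) \<longlonglongrightarrow> 0"
    using LIMSEQ_subseq_LIMSEQ[OF coord_tendsto_0[of y], of "\<lambda>n. 2 * r n + 3"] r
    by (simp add: strict_mono_def o_def)
  ultimately have "(\<lambda>n. trunc (2 * r n + 4) (shifted c) \<bullet> y + (- 3 - c - c) * coord y (2 * r n + 3))
      \<longlonglongrightarrow> shifted c \<bullet> y + (- 3 - c - c) * 0"
    by (intro tendsto_intros)
  then show "(\<lambda>n. (proj_sol \<circ> r) n \<bullet> y) \<longlonglongrightarrow> shifted c \<bullet> y"
    by (simp add: proj_sol_def c alt inner_add_left inner_commute[of "unit_ell2 _"] inner_unit_ell2)
qed

text \<open>At the moving odd index the shifted vector is 0 and the projected solution has modulus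
  5.\<close>

lemma proj_sol_not_tendsto_shifted:
  "\<not> (proj_sol \<circ> r) \<longlonglongrightarrow> shifted c"
proof
  assume "(proj_sol \<circ> r) \<longlonglongrightarrow> shifted c"
  then obtain n where n: "norm (proj_sol (r n) - shifted c) < 5"
    using LIMSEQ_D[of "proj_sol \<circ> r" "shifted c" 5] by auto
  have "\<bar>coord (proj_sol (r n) - shifted c) (2 * r n + 3)\<bar> = 5"
    by (simp add: minus_ell2.rep_eq coord_proj_sol coord_shifted alt_def)
  then show False
    using n abs_coord_le_norm[of "proj_sol (r n) - shifted c" "2 * r n + 3"] by simp
qed

section \<open>Excluding limits by means of coordinate 0\<close>

lemma coord_0_proj_sol: "coord (proj_sol n) 0 = 1 - alt n"
  by (simp add: coord_proj_sol coord_shifted alt_def)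

lemma weakly_tendsto_on_coord:
  assumes "weakly_tendsto_on UNIV f l"
  shows "(\<lambda>n. coord (f n) i) \<longlonglongrightarrow> coord l i"
  using assms unfolding weakly_tendsto_on_def by (metis (no_types, lifting) ext UNIV_I inner_unit_ell2)

lemma proj_sol_no_weak_limit: "\<not> weakly_tendsto_on UNIV proj_sol l"
proof
  assume "weakly_tendsto_on UNIV proj_sol l"
  then have lim: "(\<lambda>n. coord (proj_sol n) 0) \<longlonglongrightarrow> coord l 0"
    by (rule weakly_tendsto_on_coord)
  have "coord l 0 = 0"
    using LIMSEQ_subseq_LIMSEQ[OF lim, of "\<lambda>n. 2 * n"]
    by (simp add: strict_mono_def o_def coord_0_proj_sol alt_def LIMSEQ_const_iff)
  moreover have "coord l 0 = 5"
    using LIMSEQ_subseq_LIMSEQ[OF lim, of "\<lambda>n. 2 * n + 1"]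
    by (simp add: strict_mono_def o_def coord_0_proj_sol alt_def LIMSEQ_const_iff)
  ultimately show False
    by simp
qed

text \<open>Coordinate 0 would force \<open>alt (r n)\<close> to tend to 0, but its modulus is at
  least 1.\<close>

lemma proj_sol_subseq_not_weakly_sol: "\<not> weakly_tendsto_on UNIV (proj_sol \<circ> r) sol"
proof
  assume "weakly_tendsto_on UNIV (proj_sol \<circ> r) sol"
  then have "(\<lambda>n. coord (proj_sol (r n)) 0) \<longlonglongrightarrow> coord sol 0"
    using weakly_tendsto_on_coord by fastforce
  then have "(\<lambda>n. 1 - alt (r n)) \<longlonglongrightarrow> 1"
    by (simp add: coord_0_proj_sol sol.rep_eq alt_def)
  then obtain n where "\<bar>alt (r n)\<bar> < 1"
    using LIMSEQ_D[of "\<lambda>n. 1 - alt (r n)" 1 1] by auto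
  then show False
    by (simp add: alt_def split: if_splits)
qed

theorem theorem28:
  shows "\<exists>(X :: ell2 set) (Y :: ell2 set) (A :: ell2 \<Rightarrow> ell2) (xd :: ell2)
            (V :: nat \<Rightarrow> ell2 set) (u :: ell2) (v :: ell2).
      hilbert_subspace X \<and> hilbert_subspace Y \<and>
      bounded_linear_between X Y A \<and>
      xd \<in> X \<inter> (nullspace_on X A)\<^sup>\<bottom> \<and>
      (\<forall>n. finite_dim_subspace (V n) \<and> V n \<subseteq> X \<and> V n \<subseteq> V (Suc n)) \<and>
      closure (\<Union>n. V n) = X \<and>
      u \<in> X \<and> v \<in> X \<and> u \<noteq> xd \<and> v \<noteq> xd \<and>
      (let x = (\<lambda>n. pseudoinverse X (A \<circ> orth_projector (V n)) (A xd)) in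
        weakly_tendsto_on X (\<lambda>n. x (2 * n)) u \<and>
        \<not> (\<lambda>n. x (2 * n)) \<longlonglongrightarrow> u \<and>
        weakly_tendsto_on X (\<lambda>n. x (2 * n + 1)) v \<and>
        \<not> (\<lambda>n. x (2 * n + 1)) \<longlonglongrightarrow> v \<and>
        \<not> (\<exists>l\<in>X. weakly_tendsto_on X x l) \<and>
        \<not> (\<exists>l\<in>X. x \<longlonglongrightarrow> l) \<and>
        (\<forall>r. strict_mono r \<longrightarrow> \<not> weakly_tendsto_on X (x \<circ> r) xd))"
proof -
  have hilbert: "hilbert_subspace (UNIV :: ell2 set)"
    by (simp add: hilbert_subspace_def complete_UNIV)
  have bounded: "bounded_linear_between UNIV UNIV diff_op"
    unfolding bounded_linear_between_def
    using norm_diff_op_le linear_add[OF linear_diff_op] linear_scale[OF linear_diff_op] by auto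
  have orth: "sol \<in> UNIV \<inter> (nullspace_on UNIV diff_op)\<^sup>\<bottom>"
    using sol_orth_nullspace
    by (auto simp: nullspace_on_def orthogonal_comp_def orthogonal_def inner_commute)
  \<comment> \<open>Coordinate 0 takes the values 0 and 5 against 1 for \<open>sol\<close>.\<close>
  have neq: "shifted 1 \<noteq> sol" "shifted (- 4) \<noteq> sol"
    by (auto simp: dest!: arg_cong[of _ _ "\<lambda>x. coord x 0"] simp: coord_shifted sol.rep_eq)
  have weak: "weakly_tendsto_on UNIV (\<lambda>n. proj_sol (2 * n)) (shifted 1)"
      "weakly_tendsto_on UNIV (\<lambda>n. proj_sol (2 * n + 1)) (shifted (- 4))"
    using proj_sol_weak_limit[of "\<lambda>n. 2 * n" 1] proj_sol_weak_limit[of "\<lambda>n. 2 * n + 1" "- 4"]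
    by (simp_all add: strict_mono_def o_def alt_def)
  have not_strong: "\<not> (\<lambda>n. proj_sol (2 * n)) \<longlonglongrightarrow> shifted 1"
      "\<not> (\<lambda>n. proj_sol (2 * n + 1)) \<longlonglongrightarrow> shifted (- 4)"
    using proj_sol_not_tendsto_shifted[of "\<lambda>n. 2 * n"] proj_sol_not_tendsto_shifted[of "\<lambda>n. 2 * n + 1"]
    by (simp_all add: o_def)
  \<comment> \<open>A norm limit would also be a weak limit.\<close>
  have no_limit: "\<not> proj_sol \<longlonglongrightarrow> l" for l
    using proj_sol_no_weak_limit[of l] unfolding weakly_tendsto_on_def
    by (auto intro!: tendsto_intros)
  show ?thesis
    by (rule exI[of _ UNIV], rule exI[of _ UNIV], rule exI[of _ diff_op], rule exI[of _ sol],
        rule exI[of _ approx], rule exI[of _ "shifted 1"], rule exI[of _ "shifted (- 4)"])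
      (use hilbert bounded orth neq weak not_strong no_limit proj_sol_no_weak_limit
        proj_sol_subseq_not_weakly_sol finite_dim_approx approx_mono closure_approx
        in \<open>simp add: pseudoinverse_diff_op Let_def\<close>)
qed

end
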